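(* Let $n>0$ be an integer, $m\ge0$ an integer with $m\ne n$, and $1\le j\le n$ an integer. Let $t_1<\dots<t_n$ be the roots of $\psi_n$ in $(-1,1)$ and define $\Psi_n(y,t)=\int_0^y\psi_n(x)e^{-icxt}\,dx$ for $y,t\in(-1,1)$ (and by the same formula for $y=1$). Then $$\int_{-1}^1\frac{\psi_n(t)}{t-t_j}\psi_m(t)\,dt=\frac{|\lambda_m|^2\psi_m(t_j)}{|\lambda_m|^2-|\lambda_n|^2}\Big[\int_{-1}^1\frac{\psi_n(t)\,dt}{t-t_j}+ic\lambda_n\Psi_n(1,t_j)\Big].$$
   Context: For a real number $c>0$, let $F_c[\varphi](x)=\int_{-1}^1\varphi(t)e^{icxt}\,dt$ on $L^2[-1,1]$, with eigenvalues $\lambda_0,\lambda_1,\dots$ ordered so that $|\lambda_n|\ge|\lambda_{n+1}|$ (nonzero, simple, $\lambda_n=i^n|\lambda_n|$) and corresponding real eigenfunctions $\psi_0,\psi_1,\dots$ (prolate spheroidal wave functions) with $\|\psi_n\|_{L^2[-1,1]}=1$; $\psi_n$ has the parity of $n$ and exactly $n$ simple roots in $(-1,1)$, and $\lambda_n\psi_n(x)=\int_{-1}^1\psi_n(t)e^{icxt}\,dt$. *)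

theory Defs
  imports "HOL-Analysis.Analysis"
begin

definition Fc :: "real \<Rightarrow> (real \<Rightarrow> complex) \<Rightarrow> real \<Rightarrow> complex" where
  "Fc c f x = (LINT t:{-1..1}|lborel. f t * exp (\<i> * complex_of_real (c * x * t)))"

definition pswf_roots :: "(real \<Rightarrow> real) \<Rightarrow> real set" where
  "pswf_roots f = {t. -1 < t \<and> t < 1 \<and> f t = 0}"

definition pswf_system :: "real \<Rightarrow> (nat \<Rightarrow> real \<Rightarrow> real) \<Rightarrow> (nat \<Rightarrow> complex) \<Rightarrow> bool" where
  "pswf_system c psi lam \<longleftrightarrow>
     (\<forall>n. lam n \<noteq> 0
        \<and> lam n = \<i> ^ n * complex_of_real (cmod (lam n))
        \<and> cmod (lam (Suc n)) \<le> cmod (lam n)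
        \<and> set_borel_measurable lborel {-1..1} (psi n)
        \<and> set_integrable lborel {-1..1} (\<lambda>t. (psi n t)\<^sup>2)
        \<and> (LINT t:{-1..1}|lborel. (psi n t)\<^sup>2) = 1
        \<and> (\<forall>x\<in>{-1..1}. lam n * complex_of_real (psi n x)
                          = Fc c (\<lambda>t. complex_of_real (psi n t)) x)
        \<and> (\<forall>x\<in>{-1..1}. psi n (-x) = (-1) ^ n * psi n x)
        \<and> finite (pswf_roots (psi n)) \<and> card (pswf_roots (psi n)) = n
        \<and> (\<forall>t\<in>pswf_roots (psi n). \<exists>d. (psi n has_real_derivative d) (at t) \<and> d \<noteq> 0))
   \<and> inj lam
   \<and> (\<forall>(f::real \<Rightarrow> complex) \<mu>.
        set_borel_measurable lborel {-1..1} f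
        \<and> set_integrable lborel {-1..1} (\<lambda>t. (cmod (f t))\<^sup>2)
        \<and> \<not> (AE x in lborel. x \<in> {-1..1} \<longrightarrow> f x = 0)
        \<and> (AE x in lborel. x \<in> {-1..1} \<longrightarrow> \<mu> * f x = Fc c f x)
        \<longrightarrow> (\<exists>k a. \<mu> = lam k \<and>
               (AE x in lborel. x \<in> {-1..1} \<longrightarrow> f x = a * complex_of_real (psi k x))))"

text \<open>Psi_n(y,t) = int_0^y psi_n(x) e^{-icxt} dx (for y \<ge> 0).\<close>
definition Psi :: "real \<Rightarrow> (real \<Rightarrow> real) \<Rightarrow> real \<Rightarrow> real \<Rightarrow> complex" where
  "Psi c f y t = (LINT x:{0..y}|lborel. complex_of_real (f x) * exp (- \<i> * complex_of_real (c * x * t)))"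

end

theory Submission
  imports Defs
begin

text \<open>
  Put \<open>f(t) = \<psi>\<^sub>n(t) / (t - t\<^sub>j)\<close>, \<open>G = F\<^sub>c f\<close> and \<open>g(x) = e\<^bsup>-icxt\<^sub>j\<^esup> G(x)\<close>. Then
  \<open>g'(x) = ic\<lambda>\<^sub>n \<psi>\<^sub>n(x) e\<^bsup>-icxt\<^sub>j\<^esup>\<close>, so \<open>g(1) = g(-1)\<close> is the bracket on the right-hand side of the
  theorem, and integrating \<open>g - g(1)\<close> by parts gives
  \<open>F\<^sub>c\<^sup>* F\<^sub>c f = |\<lambda>\<^sub>n|\<^sup>2 f + g(1) F\<^sub>c\<^sup>*(e\<^bsup>icxt\<^sub>j\<^esup>)\<close>.
  Pairing with \<open>\<psi>\<^sub>m\<close> yields the identity multiplied by \<open>|\<lambda>\<^sub>m|\<^sup>2 - |\<lambda>\<^sub>n|\<^sup>2\<close>.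

  That this factor is nonzero is not part of the hypotheses. If \<open>|\<lambda>\<^sub>m| = |\<lambda>\<^sub>n|\<close>, then comparing
  \<open>\<integral> \<psi>\<^sub>m' \<psi>\<^sub>n\<close> with \<open>\<integral> \<psi>\<^sub>m \<psi>\<^sub>n'\<close> (opposite parity), or \<open>\<integral> x \<psi>\<^sub>m' \<psi>\<^sub>n\<close> with \<open>\<integral> x \<psi>\<^sub>m \<psi>\<^sub>n'\<close>
  (equal parity), forces \<open>\<psi>\<^sub>m(1) \<psi>\<^sub>n(1) = 0\<close>. But \<open>F\<^sub>c\<close> commutes with
  \<open>L = d/dx (1 - x\<^sup>2) d/dx - c\<^sup>2 x\<^sup>2\<close>, so by simplicity of the eigenvalues \<open>\<psi>\<^sub>n\<close> is an eigenfunction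
  of \<open>L\<close>, and a solution of this equation that vanishes at the singular endpoint \<open>1\<close> vanishes
  near \<open>1\<close>, contradicting the finiteness of the set of roots.
\<close>

section \<open>The finite Fourier transform of continuous functions\<close>

definition FT :: "real \<Rightarrow> (real \<Rightarrow> complex) \<Rightarrow> real \<Rightarrow> complex" where
  "FT c f x = integral {-1..1} (\<lambda>t. f t * cis (c * x * t))"

lemma has_vector_derivative_cis_mult:
  "((\<lambda>x. cis (a * x)) has_vector_derivative \<i> * of_real a * cis (a * x)) (at x within S)"
  unfolding has_vector_derivative_def
  by (auto intro!: derivative_eq_intros simp: scaleR_conv_of_real)

text \<open>\<open>FT\<close> uses the gauge integral because Leibniz' rule, the fundamental theorem
  of calculus and the swap of iterated integrals are applied to it below. For continuous integrands
  both integrals agree.\<close>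

lemma Fc_eq_FT:
  assumes "continuous_on {-1..1} f"
  shows "Fc c f x = FT c f x"
proof -
  have "continuous_on {-1..1} (\<lambda>t. f t * cis (c * x * t))"
    by (intro continuous_intros assms)
  then show ?thesis
    unfolding Fc_def FT_def cis_conv_exp
    by (intro set_borel_integral_eq_integral(2) borel_integrable_atLeastAtMost')
qed

text \<open>Dominated convergence: the kernel has modulus 1, so |f| is a majorant. Only
  integrability may be used here, since continuity of the eigenfunctions is deduced from this
  lemma.\<close>

lemma continuous_on_Fc:
  assumes f: "set_integrable lborel {-1..1} f"
  shows "continuous_on S (Fc c f)"
proof (rule continuous_on_sequentiallyI)
  fix u a assume u: "u \<longlonglongrightarrow> (a::real)"
  have m: "(\<lambda>t. indicator {-1..1} t *\<^sub>R f t) \<in> borel_measurable lborel"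
    using f unfolding set_integrable_def by (rule borel_measurable_integrable)
  have m': "(\<lambda>t. indicator {-1..1} t *\<^sub>R (f t * exp (\<i> * complex_of_real (c * x * t)))) \<in> borel_measurable lborel" for x
  proof -
    have "(\<lambda>t. (indicator {-1..1} t *\<^sub>R f t) * exp (\<i> * complex_of_real (c * x * t))) \<in> borel_measurable lborel"
      using m by (rule borel_measurable_times) measurable
    then show ?thesis by simp
  qed
  show "(\<lambda>n. Fc c f (u n)) \<longlonglongrightarrow> Fc c f a"
    unfolding Fc_def set_lebesgue_integral_def
  proof (rule integral_dominated_convergence[where w = "\<lambda>t. norm (indicator {-1..1} t *\<^sub>R f t)"])
    show "integrable lborel (\<lambda>t. norm (indicator {-1..1} t *\<^sub>R f t))"
      using f unfolding set_integrable_def by (rule integrable_norm)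
  qed (use m' u in \<open>auto intro!: tendsto_intros simp: norm_mult\<close>)
qed

lemma set_integrable_of_square_integrable:
  fixes f :: "real \<Rightarrow> real"
  assumes "set_borel_measurable lborel {a..b} f" "set_integrable lborel {a..b} (\<lambda>t. (f t)\<^sup>2)"
  shows "set_integrable lborel {a..b} f"
proof (rule set_integrable_bound)
  show "set_integrable lborel {a..b} (\<lambda>t. 1 + (f t)\<^sup>2)"
    using borel_integrable_atLeastAtMost'[of a b "\<lambda>_. 1::real"] assms(2)
    by (intro set_integral_add) auto
  \<comment> \<open>From (|y| - 1)^2 >= 0, that is, 2|y| <= 1 + y^2.\<close>
  have "\<bar>y\<bar> \<le> 1 + y\<^sup>2" for y :: real
    using zero_le_power2[of "\<bar>y\<bar> - 1"] abs_ge_zero[of y] unfolding power2_diff power2_abs one_power2 by linarith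
  then show "AE x in lborel. x \<in> {a..b} \<longrightarrow> norm (f x) \<le> norm (1 + (f x)\<^sup>2)"
    by (auto simp: abs_of_nonneg)
qed (fact assms(1))

lemma FT_has_vector_derivative:
  assumes "continuous_on {-1..1} f"
  shows "(FT c f has_vector_derivative \<i> * of_real c * FT c (\<lambda>t. of_real t * f t) x) (at x within S)"
proof -
  have "((\<lambda>x. integral (cbox (-1) 1) (\<lambda>t. f t * cis (c * x * t)))
      has_vector_derivative integral (cbox (-1) 1) (\<lambda>t. \<i> * of_real c * (of_real t * f t * cis (c * x * t))))
      (at x within UNIV)"
  proof (rule leibniz_rule_vector_derivative)
    show "((\<lambda>x. f t * cis (c * x * t)) has_vector_derivative \<i> * of_real c * (of_real t * f t * cis (c * x * t)))
      (at x within UNIV)" for x t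
      using has_vector_derivative_mult_right[OF has_vector_derivative_cis_mult[of "c*t" x UNIV], of "f t"]
      by (simp add: ac_simps)
    show "(\<lambda>t. f t * cis (c * x * t)) integrable_on cbox (-1) 1" for x
      using assms by (intro integrable_continuous continuous_intros) auto
    show "continuous_on (UNIV \<times> cbox (-1) 1) (\<lambda>(x, t). \<i> * of_real c * (of_real t * f t * cis (c * x * t)))"
      unfolding case_prod_unfold
      by (intro continuous_intros continuous_on_compose2[OF assms]) auto
  qed auto
  then show ?thesis
    unfolding FT_def[abs_def] by (auto intro: has_vector_derivative_at_within)
qed

lemma continuous_on_FT:
  assumes "continuous_on {-1..1} f"
  shows "continuous_on S (FT c f)"
  by (meson FT_has_vector_derivative[OF assms] continuous_on_eq_continuous_within has_vector_derivative_continuous)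

text \<open>The kernel is symmetric in x and t, so the transform is symmetric for the bilinear
  pairing without conjugation.\<close>

lemma integral_FT_swap:
  assumes f: "continuous_on {-1..1} f" and g: "continuous_on {-1..1} g"
  shows "integral {-1..1} (\<lambda>x. FT c f x * g x) = integral {-1..1} (\<lambda>x. f x * FT c g x)"
proof -
  have "integral {-1..1} (\<lambda>x. FT c f x * g x)
      = integral (cbox (-1) 1) (\<lambda>x. integral (cbox (-1) 1) (\<lambda>t. f t * cis (c * x * t) * g x))"
    unfolding FT_def by simp
  also have "\<dots> = integral (cbox (-1) 1) (\<lambda>t. integral (cbox (-1) 1) (\<lambda>x. f t * cis (c * x * t) * g x))"
    unfolding case_prod_unfold
    by (intro integral_swap_continuous, unfold case_prod_unfold,
      intro continuous_intros continuous_on_compose2[OF f] continuous_on_compose2[OF g]) auto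
  also have "\<dots> = integral {-1..1} (\<lambda>x. f x * FT c g x)"
    unfolding FT_def by (simp add: ac_simps flip: integral_mult_right)
  finally show ?thesis .
qed

text \<open>Identifies \<open>FT (- c)\<close> as the adjoint transform.\<close>

lemma cnj_FT: "cnj (FT c f x) = FT (- c) (\<lambda>t. cnj (f t)) x"
  by (simp add: FT_def integral_cnj cis_cnj)

lemma has_integral_FT:
  assumes "continuous_on {-1..1} f"
  shows "((\<lambda>t. f t * cis (c * x * t)) has_integral FT c f x) {-1..1}"
  unfolding FT_def by (intro integrable_integral integrable_continuous_real continuous_intros assms)

section \<open>One eigenfunction: derivatives, the commuting operator L, the endpoint 1\<close>

locale FT_eigenfunction =
  fixes c :: real and l :: complex and u :: "real \<Rightarrow> complex"
  assumes l_nonzero: "l \<noteq> 0"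
    and cont: "continuous_on {-1..1} u"
    and eigen: "\<And>x. x \<in> {-1..1} \<Longrightarrow> FT c u x = l * u x"
begin

text \<open>On [-1,1] this is u', found by differentiating l u = F_c u under the integral. Written
  as a transform it is continuous on the whole line and can be moved to the other factor by
  \<open>integral_FT_swap\<close>; \<open>ddu\<close> repeats this for u''.\<close>

definition du :: "real \<Rightarrow> complex" where
  "du x = \<i> * of_real c / l * FT c (\<lambda>t. of_real t * u t) x"

definition ddu :: "real \<Rightarrow> complex" where
  "ddu x = - of_real (c\<^sup>2) / l * FT c (\<lambda>t. of_real (t\<^sup>2) * u t) x"

definition Lu :: "real \<Rightarrow> complex" where
  "Lu x = of_real (1 - x\<^sup>2) * ddu x - of_real (2 * x) * du x - of_real (c\<^sup>2 * x\<^sup>2) * u x"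

lemma cont_mult_of_real:
  "continuous_on {-1..1} (\<lambda>t. of_real t * u t)" "continuous_on {-1..1} (\<lambda>t. of_real (t\<^sup>2) * u t)"
  by (intro continuous_intros cont)+

lemma cont_du: "continuous_on S du"
  unfolding du_def[abs_def] by (intro continuous_intros continuous_on_FT cont)

lemma cont_ddu: "continuous_on S ddu"
  unfolding ddu_def[abs_def] by (intro continuous_intros continuous_on_FT cont)

lemma cont_Lu: "continuous_on {-1..1} Lu"
  unfolding Lu_def[abs_def] by (intro continuous_intros cont cont_du cont_ddu)

lemma u_deriv:
  assumes "x \<in> {-1..1}"
  shows "(u has_vector_derivative du x) (at x within {-1..1})"
proof (rule has_vector_derivative_transform[OF assms])
  show "((\<lambda>x. 1 / l * FT c u x) has_vector_derivative du x) (at x within {-1..1})"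
    using has_vector_derivative_mult_right[OF FT_has_vector_derivative[OF cont], of "1/l" c x "{-1..1}"]
    by (simp add: du_def)
qed (simp add: eigen l_nonzero)

lemma du_deriv: "(du has_vector_derivative ddu x) (at x within S)"
proof -
  have "\<i> * of_real c / l * (\<i> * of_real c * FT c (\<lambda>t. of_real t * (of_real t * u t)) x) = ddu x"
    by (simp add: ddu_def power2_eq_square mult.assoc mult.left_commute[of "of_real c" \<i>])
  with has_vector_derivative_mult_right[OF FT_has_vector_derivative[OF cont_mult_of_real(1)], of "\<i> * of_real c / l" c x S]
  show ?thesis by (simp add: du_def[abs_def])
qed

lemma l_du: "l * du x = \<i> * of_real c * FT c (\<lambda>t. of_real t * u t) x"
  using l_nonzero by (simp add: du_def)

text \<open>The divergence form of L, used for the commutation with F_c and for the estimate near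
  1.\<close>

lemma one_minus_square_du_deriv:
  "((\<lambda>t. of_real (1 - t\<^sup>2) * du t) has_vector_derivative Lu x + of_real (c\<^sup>2 * x\<^sup>2) * u x) (at x within S)"
proof -
  have "((\<lambda>t. complex_of_real (1 - t\<^sup>2)) has_vector_derivative of_real (- 2 * x)) (at x within S)"
    by (intro has_vector_derivative_of_real) (auto intro!: derivative_eq_intros)
  from has_vector_derivative_mult[OF this du_deriv] show ?thesis
    by (simp add: Lu_def algebra_simps)
qed

text \<open>Two integrations by parts, combined into the single antiderivative \<open>W\<close>; its factor
  \<open>1 - t\<^sup>2\<close> kills the boundary terms.\<close>
lemma Lu_eigen:
  assumes "x \<in> {-1..1}"
  shows "FT c Lu x = l * Lu x"
proof -
  define e where "e t = cis (c * x * t)" for t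
  define W where "W t = of_real (1 - t\<^sup>2) * du t * e t - \<i> * of_real (c * x) * (of_real (1 - t\<^sup>2) * u t * e t)" for t
  define W' where "W' t = (Lu t + of_real (c\<^sup>2 * t\<^sup>2) * u t) * e t + 2 * \<i> * of_real (c * x) * (of_real t * u t * e t)
      + of_real (c\<^sup>2 * x\<^sup>2) * (u t * e t) - of_real (c\<^sup>2 * x\<^sup>2) * (of_real (t\<^sup>2) * u t * e t)" for t
  have e_deriv: "(e has_vector_derivative \<i> * of_real (c * x) * e t) (at t within {-1..1})" for t
    unfolding e_def[abs_def] by (rule has_vector_derivative_cis_mult)
  have W: "(W has_vector_derivative W' t) (at t within {-1..1})" if t: "t \<in> {-1..1}" for t
  proof -
    have "((\<lambda>t. complex_of_real (1 - t\<^sup>2)) has_vector_derivative of_real (- 2 * t)) (at t within {-1..1})"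
      by (intro has_vector_derivative_of_real) (auto intro!: derivative_eq_intros)
    from has_vector_derivative_mult_right[OF has_vector_derivative_mult[OF has_vector_derivative_mult[OF this u_deriv[OF t]] e_deriv]]
    have 1: "((\<lambda>t. \<i> * of_real (c * x) * (of_real (1 - t\<^sup>2) * u t * e t)) has_vector_derivative
       \<i> * of_real (c * x) * (of_real (1 - t\<^sup>2) * u t * (\<i> * of_real (c * x) * e t)
       + (of_real (1 - t\<^sup>2) * du t + of_real (- 2 * t) * u t) * e t)) (at t within {-1..1})"
      by simp
    have 2: "((\<lambda>t. of_real (1 - t\<^sup>2) * du t * e t) has_vector_derivative
       of_real (1 - t\<^sup>2) * du t * (\<i> * of_real (c * x) * e t) + (Lu t + of_real (c\<^sup>2 * t\<^sup>2) * u t) * e t) (at t within {-1..1})"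
      by (rule has_vector_derivative_mult[OF one_minus_square_du_deriv e_deriv])
    have eq: "of_real (1 - t\<^sup>2) * du t * (\<i> * of_real (c * x) * e t) + (Lu t + of_real (c\<^sup>2 * t\<^sup>2) * u t) * e t
       - \<i> * of_real (c * x) * (of_real (1 - t\<^sup>2) * u t * (\<i> * of_real (c * x) * e t)
       + (of_real (1 - t\<^sup>2) * du t + of_real (- 2 * t) * u t) * e t) = W' t"
      unfolding W'_def by (simp add: algebra_simps power2_eq_square)
    show ?thesis
      using has_vector_derivative_diff[OF 2 1] unfolding W_def[abs_def] eq .
  qed
  have "(W' has_integral W 1 - W (-1)) {-1..1}"
    by (rule fundamental_theorem_of_calculus) (auto intro: W)
  then have "(W' has_integral 0) {-1..1}"
    by (simp add: W_def)
  moreover note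
    has_integral_FT[OF cont_mult_of_real(2), of c x, folded e_def]
    has_integral_FT[OF cont_mult_of_real(1), of c x, folded e_def]
    has_integral_FT[OF cont, of c x, folded e_def]
  ultimately have "((\<lambda>t. W' t - of_real (c\<^sup>2) * (of_real (t\<^sup>2) * u t * e t)
      - 2 * \<i> * of_real (c * x) * (of_real t * u t * e t)
      - of_real (c\<^sup>2 * x\<^sup>2) * (u t * e t) + of_real (c\<^sup>2 * x\<^sup>2) * (of_real (t\<^sup>2) * u t * e t)) has_integral
      0 - of_real (c\<^sup>2) * FT c (\<lambda>t. of_real (t\<^sup>2) * u t) x
      - 2 * \<i> * of_real (c * x) * FT c (\<lambda>t. of_real t * u t) x
      - of_real (c\<^sup>2 * x\<^sup>2) * FT c u x + of_real (c\<^sup>2 * x\<^sup>2) * FT c (\<lambda>t. of_real (t\<^sup>2) * u t) x) {-1..1}"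
    by (intro has_integral_diff has_integral_add has_integral_mult_right)
  moreover have "(\<lambda>t. W' t - of_real (c\<^sup>2) * (of_real (t\<^sup>2) * u t * e t)
      - 2 * \<i> * of_real (c * x) * (of_real t * u t * e t)
      - of_real (c\<^sup>2 * x\<^sup>2) * (u t * e t) + of_real (c\<^sup>2 * x\<^sup>2) * (of_real (t\<^sup>2) * u t * e t)) = (\<lambda>t. Lu t * e t)"
    unfolding W'_def by (simp add: fun_eq_iff algebra_simps)
  ultimately have "FT c Lu x = 0 - of_real (c\<^sup>2) * FT c (\<lambda>t. of_real (t\<^sup>2) * u t) x
      - 2 * \<i> * of_real (c * x) * FT c (\<lambda>t. of_real t * u t) x
      - of_real (c\<^sup>2 * x\<^sup>2) * FT c u x + of_real (c\<^sup>2 * x\<^sup>2) * FT c (\<lambda>t. of_real (t\<^sup>2) * u t) x"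
    unfolding FT_def[of c Lu] e_def by (simp add: integral_unique)
  \<comment> \<open>The moments of order 2, 1, 0 are \<open>ddu\<close>, \<open>du\<close>,
    \<open>u\<close> up to factors. The potential c^2 t^2 of L returns as the leading part of u'',
    and the term c^2 x^2 from the kernel returns as the potential.\<close>
  also have "\<dots> = l * Lu x"
    unfolding Lu_def ddu_def du_def eigen[OF assms] using l_nonzero by (simp add: field_simps)
  finally show ?thesis .
qed

text \<open>The flux (1 - x^2) u' vanishes at 1, so integrating the equation over [x,1] bounds |u'|
  near 1 by K times the maximum M of |u| on [d,1]. With u(1) = 0 the mean value inequality then
  gives M <= M/2.\<close>

lemma vanishes_near_1:
  assumes AE: "AE x in lborel. x \<in> {-1..1} \<longrightarrow> Lu x = a * u x" and u1: "u 1 = 0"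
  obtains d where "0 \<le> d" "d < 1" "\<And>x. x \<in> {d..1} \<Longrightarrow> u x = 0"
proof -
  \<comment> \<open>K bounds |a + c^2 t^2| on [-1,1], and d is chosen so that K (1 - d) =
    1/2.\<close>
  define K where "K = cmod a + c\<^sup>2 + 1"
  have K: "K \<ge> 1" by (simp add: K_def)
  define d where "d = 1 - 1 / (2 * K)"
  have d: "0 \<le> d" "d < 1" using K by (auto simp: d_def field_simps)
  have "continuous_on {d..1} (\<lambda>x. cmod (u x))"
    using d by (intro continuous_intros continuous_on_subset[OF cont]) auto
  then obtain x0 where x0: "x0 \<in> {d..1}" "\<And>y. y \<in> {d..1} \<Longrightarrow> cmod (u y) \<le> cmod (u x0)"
    using continuous_attains_sup[of "{d..1}" "\<lambda>x. cmod (u x)"] d by auto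
  define M where "M = cmod (u x0)"
  have du_le: "cmod (du x) \<le> K * M" if x: "x \<in> {d..<1}" for x
  proof -
    have "((\<lambda>t. Lu t + of_real (c\<^sup>2 * t\<^sup>2) * u t) has_integral
        of_real (1 - 1\<^sup>2) * du 1 - of_real (1 - x\<^sup>2) * du x) {x..1}"
      using x by (intro fundamental_theorem_of_calculus one_minus_square_du_deriv) auto
    moreover have "AE t in lborel. t \<in> {x..1} \<longrightarrow>
        Lu t + of_real (c\<^sup>2 * t\<^sup>2) * u t = (a + of_real (c\<^sup>2 * t\<^sup>2)) * u t"
      using AE by eventually_elim (use x d in \<open>auto simp: algebra_simps\<close>)
    ultimately have I: "((\<lambda>t. (a + of_real (c\<^sup>2 * t\<^sup>2)) * u t) has_integral - (of_real (1 - x\<^sup>2) * du x)) {x..1}"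
      by (simp add: has_integral_AE)
    have "cmod (- (of_real (1 - x\<^sup>2) * du x)) \<le> K * M * measure lborel {x..1}"
    proof (rule has_integral_bound_real[OF _ finite.emptyI I])
      fix t assume "t \<in> {x..1} - {}"
      then have t: "t \<in> {d..1}" "t\<^sup>2 \<le> 1" using x d by (auto simp: abs_square_le_1)
      have "cmod (a + of_real (c\<^sup>2 * t\<^sup>2)) \<le> cmod a + cmod (of_real (c\<^sup>2 * t\<^sup>2))"
        by (rule norm_triangle_ineq)
      also have "\<dots> \<le> K"
        using mult_left_mono[OF t(2), of "c\<^sup>2"] by (simp add: K_def norm_mult norm_power)
      finally show "cmod ((a + of_real (c\<^sup>2 * t\<^sup>2)) * u t) \<le> K * M"
        unfolding norm_mult M_def using x0(2)[OF t(1)] K by (intro mult_mono) auto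
    qed (use K in \<open>simp add: M_def\<close>)
    moreover have "cmod (- (of_real (1 - x\<^sup>2) * du x)) = (1 - x\<^sup>2) * cmod (du x)"
      using x d unfolding norm_minus_cancel norm_mult norm_of_real by (simp add: abs_square_le_1)
    \<comment> \<open>The length 1 - x of the interval cancels the singular factor of 1 -
      x^2.\<close>
    ultimately have "(1 - x) * ((1 + x) * cmod (du x)) \<le> (1 - x) * (K * M)"
      using x by (simp add: algebra_simps power2_eq_square)
    then have "(1 + x) * cmod (du x) \<le> K * M"
      using x by simp
    moreover have "1 * cmod (du x) \<le> (1 + x) * cmod (du x)"
      using x d by (intro mult_right_mono) auto
    ultimately show ?thesis by simp
  qed
  have "M \<le> K * M * (1 - x0)"
  proof (cases "x0 = 1")
    case False
    then have "x0 < 1" using x0 by simp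
    have "norm (u 1 - u x0) \<le> K * M * 1 - K * M * x0"
    proof (rule differentiable_bound_general[where f' = du and \<phi> = "\<lambda>x. K * M * x" and \<phi>' = "\<lambda>_. K * M"])
      show "(u has_vector_derivative du x) (at x)" if "x0 < x" "x < 1" for x
        using u_deriv[of x] that x0 d at_within_Icc_at[of "-1" x 1] by simp
      show "((\<lambda>x. K * M * x) has_vector_derivative K * M) (at x)" for x
        by (auto intro!: derivative_eq_intros simp flip: has_real_derivative_iff_has_vector_derivative)
    qed (use \<open>x0 < 1\<close> x0 d du_le in \<open>auto intro!: continuous_intros continuous_on_subset[OF cont]\<close>)
    then show ?thesis by (simp add: u1 M_def algebra_simps)
  qed (simp add: M_def u1)
  also have "\<dots> \<le> K * M * (1 / (2 * K))"
    using x0 K by (intro mult_left_mono) (auto simp: d_def M_def)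
  also have "\<dots> = M / 2" using K by simp
  finally have "M = 0" by (simp add: M_def)
  then show ?thesis using that[of d] d x0(2) by (auto simp: M_def)
qed

end

section \<open>Integral identities for two eigenfunctions\<close>

locale FT_eigenfunction_pair = U: FT_eigenfunction c l u + V: FT_eigenfunction c k v
  for c l u k v
begin

lemma integral_scaled_swap:
  "l * integral {-1..1} (\<lambda>x. u x * v x) = k * integral {-1..1} (\<lambda>x. u x * v x)"
proof -
  have "l * integral {-1..1} (\<lambda>x. u x * v x) = integral {-1..1} (\<lambda>x. FT c u x * v x)"
    unfolding integral_mult_right[symmetric] by (rule integral_cong) (simp add: U.eigen)
  also have "\<dots> = integral {-1..1} (\<lambda>x. u x * FT c v x)"
    by (rule integral_FT_swap[OF U.cont V.cont])
  also have "\<dots> = k * integral {-1..1} (\<lambda>x. u x * v x)"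
    unfolding integral_mult_right[symmetric] by (rule integral_cong) (simp add: V.eigen)
  finally show ?thesis .
qed

lemma integral_du_v:
  "l * integral {-1..1} (\<lambda>x. U.du x * v x) = \<i> * of_real c * k * integral {-1..1} (\<lambda>x. of_real x * u x * v x)"
proof -
  have "l * integral {-1..1} (\<lambda>x. U.du x * v x)
      = \<i> * of_real c * integral {-1..1} (\<lambda>x. FT c (\<lambda>t. of_real t * u t) x * v x)"
    unfolding integral_mult_right[symmetric] mult.assoc[symmetric] U.l_du ..
  also have "\<dots> = \<i> * of_real c * integral {-1..1} (\<lambda>x. of_real x * u x * FT c v x)"
    by (simp add: integral_FT_swap U.cont_mult_of_real V.cont)
  also have "integral {-1..1} (\<lambda>x. of_real x * u x * FT c v x) = k * integral {-1..1} (\<lambda>x. of_real x * u x * v x)"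
    unfolding integral_mult_right[symmetric] by (rule integral_cong) (simp add: V.eigen)
  finally show ?thesis by (simp add: mult.assoc)
qed

text \<open>Both \<open>U.du\<close> and \<open>V.du\<close> are transforms, of t u and t v up to
  factors, so the symmetry of the transform exchanges them.\<close>

lemma integral_x_du_v:
  "l * integral {-1..1} (\<lambda>x. of_real x * U.du x * v x) = k * integral {-1..1} (\<lambda>x. of_real x * u x * V.du x)"
proof -
  have "l * integral {-1..1} (\<lambda>x. of_real x * U.du x * v x)
      = integral {-1..1} (\<lambda>x. (l * U.du x) * (of_real x * v x))"
    unfolding integral_mult_right[symmetric] by (simp add: ac_simps)
  also have "\<dots> = \<i> * of_real c * integral {-1..1} (\<lambda>x. FT c (\<lambda>t. of_real t * u t) x * (of_real x * v x))"
    unfolding integral_mult_right[symmetric] U.l_du by (simp add: mult.assoc)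
  also have "\<dots> = \<i> * of_real c * integral {-1..1} (\<lambda>x. of_real x * u x * FT c (\<lambda>t. of_real t * v t) x)"
    by (simp add: integral_FT_swap U.cont_mult_of_real V.cont_mult_of_real)
  also have "\<dots> = integral {-1..1} (\<lambda>x. of_real x * u x * (k * V.du x))"
    unfolding integral_mult_right[symmetric] V.l_du by (simp add: ac_simps)
  also have "\<dots> = k * integral {-1..1} (\<lambda>x. of_real x * u x * V.du x)"
    unfolding integral_mult_right[symmetric] by (simp add: ac_simps)
  finally show ?thesis .
qed

lemma integrable:
  "(\<lambda>x. u x * v x) integrable_on {-1..1}"
  "(\<lambda>x. U.du x * v x) integrable_on {-1..1}" "(\<lambda>x. u x * V.du x) integrable_on {-1..1}"
  "(\<lambda>x. of_real x * U.du x * v x) integrable_on {-1..1}" "(\<lambda>x. of_real x * u x * V.du x) integrable_on {-1..1}"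
  by (intro integrable_continuous_real continuous_intros U.cont V.cont U.cont_du V.cont_du)+

lemma uv_deriv:
  "x \<in> {-1..1} \<Longrightarrow> ((\<lambda>x. u x * v x) has_vector_derivative u x * V.du x + U.du x * v x) (at x within {-1..1})"
  by (intro has_vector_derivative_mult U.u_deriv V.u_deriv)

lemma integral_by_parts:
  "integral {-1..1} (\<lambda>x. u x * V.du x) + integral {-1..1} (\<lambda>x. U.du x * v x) = u 1 * v 1 - u (-1) * v (-1)"
  using fundamental_theorem_of_calculus[of "-1" 1 "\<lambda>x. u x * v x", OF _ uv_deriv]
  by (simp add: integral_unique integrable flip: Henstock_Kurzweil_Integration.integral_add)

lemma integral_x_by_parts:
  "integral {-1..1} (\<lambda>x. of_real x * u x * V.du x) + integral {-1..1} (\<lambda>x. of_real x * U.du x * v x)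
    + integral {-1..1} (\<lambda>x. u x * v x) = u 1 * v 1 + u (-1) * v (-1)"
proof -
  have "((\<lambda>x. of_real x * u x * V.du x + of_real x * U.du x * v x + u x * v x) has_integral
     of_real 1 * (u 1 * v 1) - of_real (-1) * (u (-1) * v (-1))) {-1..1}"
  proof (rule fundamental_theorem_of_calculus)
    fix x :: real assume x: "x \<in> {-1..1}"
    have "(complex_of_real has_vector_derivative of_real 1) (at x within {-1..1})"
      by (intro has_vector_derivative_of_real) auto
    from has_vector_derivative_mult[OF this uv_deriv[OF x]]
    show "((\<lambda>x. of_real x * (u x * v x)) has_vector_derivative
      of_real x * u x * V.du x + of_real x * U.du x * v x + u x * v x) (at x within {-1..1})"
      by (simp add: algebra_simps)
  qed simp
  then show ?thesis
    by (simp add: integral_unique integrable integrable_add flip: Henstock_Kurzweil_Integration.integral_add)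
qed

text \<open>Times k l, the sum of the integrals of u v' and u' v is a multiple of k^2 + l^2 = 0,
  while by parts it equals 2 u(1) v(1).\<close>

lemma boundary_zero_if_squares_opposite:
  assumes "k\<^sup>2 = - l\<^sup>2" "u (-1) * v (-1) = - (u 1 * v 1)"
  shows "u 1 * v 1 = 0"
proof -
  interpret VU: FT_eigenfunction_pair c k v l u ..
  define T where "T = integral {-1..1} (\<lambda>x. of_real x * u x * v x)"
  have "l * integral {-1..1} (\<lambda>x. U.du x * v x) = \<i> * of_real c * k * T"
    "k * integral {-1..1} (\<lambda>x. u x * V.du x) = \<i> * of_real c * l * T"
    using integral_du_v VU.integral_du_v by (simp_all add: T_def ac_simps)
  then have "k * l * (integral {-1..1} (\<lambda>x. u x * V.du x) + integral {-1..1} (\<lambda>x. U.du x * v x))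
      = \<i> * of_real c * T * (k\<^sup>2 + l\<^sup>2)"
    by (simp add: algebra_simps power2_eq_square)
  then show ?thesis
    using U.l_nonzero V.l_nonzero assms by (simp add: integral_by_parts)
qed

text \<open>For k = -l the functions are orthogonal and the two x-weighted integrals cancel;
  integrating by parts leaves 2 u(1) v(1) = 0.\<close>

lemma boundary_zero_if_opposite:
  assumes "k = - l" "u (-1) * v (-1) = u 1 * v 1"
  shows "u 1 * v 1 = 0"
proof -
  have "integral {-1..1} (\<lambda>x. u x * v x) = 0"
    using integral_scaled_swap U.l_nonzero assms(1) by simp
  moreover have "l * (integral {-1..1} (\<lambda>x. of_real x * u x * V.du x)
      + integral {-1..1} (\<lambda>x. of_real x * U.du x * v x)) = 0"
    unfolding distrib_left integral_x_du_v by (simp add: assms(1))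
  ultimately show ?thesis
    using integral_x_by_parts assms(2) U.l_nonzero by simp
qed

text \<open>The main computation, with s for the root and f for u / (t - s) with its singularity
  removed. The difference of squared moduli stays a factor here and is shown to be nonzero
  separately.\<close>

lemma integral_divided_difference:
  assumes c: "c \<noteq> 0" and real: "\<And>x. cnj (u x) = u x" "\<And>x. cnj (v x) = v x"
    and s: "s \<in> {-1..1}" "u s = 0"
    and f: "continuous_on {-1..1} f" "\<And>t. t \<in> {-1..1} \<Longrightarrow> of_real (t - s) * f t = u t"
  shows "of_real ((cmod k)\<^sup>2 - (cmod l)\<^sup>2) * integral {-1..1} (\<lambda>t. f t * v t)
    = of_real ((cmod k)\<^sup>2) * v s * (integral {-1..1} f
        + \<i> * of_real c * l * integral {0..1} (\<lambda>x. u x * cis (- (c * x * s))))"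
proof -
  \<comment> \<open>Conjugating the eigenvalue equation of a real function.\<close>
  have eigen_neg: "FT (- c) u x = cnj l * u x" "FT (- c) v x = cnj k * v x" if "x \<in> {-1..1}" for x
    using arg_cong[OF U.eigen[OF that], of cnj] arg_cong[OF V.eigen[OF that], of cnj] real
    by (simp_all add: cnj_FT)
  define G where "G = FT c f"
  define g where "g x = cis (- c * s * x) * G x" for x
  have G: "continuous_on S G" for S
    unfolding G_def by (rule continuous_on_FT[OF f(1)])
  \<comment> \<open>Since t f = u + s f, G solves a linear first-order equation whose integrating
    factor is the exponential in \<open>g\<close>.\<close>
  have G_deriv: "(G has_vector_derivative \<i> * of_real c * (l * u x + of_real s * G x)) (at x within S)"
    if x: "x \<in> {-1..1}" for x S
  proof -
    have "FT c (\<lambda>t. of_real t * f t) x = integral {-1..1} (\<lambda>t. u t * cis (c * x * t) + of_real s * (f t * cis (c * x * t)))"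
      unfolding FT_def by (rule integral_cong) (simp add: f(2)[symmetric] algebra_simps)
    also have "\<dots> = FT c u x + of_real s * G x"
      by (intro integral_unique has_integral_add has_integral_mult_right)
        (auto simp: G_def intro: has_integral_FT U.cont f)
    finally show ?thesis
      using FT_has_vector_derivative[OF f(1), of c x S] x by (simp add: G_def U.eigen)
  qed
  have g_deriv: "(g has_vector_derivative \<i> * of_real c * l * (u x * cis (- c * s * x))) (at x within S)"
    if x: "x \<in> {-1..1}" for x S
    using has_vector_derivative_mult[OF has_vector_derivative_cis_mult[of "- c * s" x S] G_deriv[OF x]]
    by (simp add: g_def[abs_def] algebra_simps)
  have "((\<lambda>x. \<i> * of_real c * l * (u x * cis (- c * s * x))) has_integral g 1 - g (-1)) {-1..1}"
    by (intro fundamental_theorem_of_calculus g_deriv) auto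
  moreover have "((\<lambda>x. \<i> * of_real c * l * (u x * cis (- c * s * x))) has_integral \<i> * of_real c * l * FT (- c) u s) {-1..1}"
    by (intro has_integral_mult_right has_integral_FT U.cont)
  \<comment> \<open>The increment of g over [-1,1] is a multiple of u(s) = 0.\<close>
  ultimately have g_end: "g (-1) = g 1"
    using eigen_neg(1)[OF s(1)] s(2) by (auto dest: has_integral_unique)
  have "((\<lambda>x. \<i> * of_real c * l * (u x * cis (- c * s * x))) has_integral g 1 - g 0) {0..1}"
    by (intro fundamental_theorem_of_calculus g_deriv) auto
  from integral_unique[OF this] have "g 1 - g 0 = \<i> * of_real c * l * integral {0..1} (\<lambda>x. u x * cis (- (c * x * s)))"
    by (simp add: ac_simps)
  moreover have "g 0 = integral {-1..1} f"
    by (simp add: g_def G_def FT_def)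
  ultimately have g1: "g 1 = integral {-1..1} f + \<i> * of_real c * l * integral {0..1} (\<lambda>x. u x * cis (- (c * x * s)))"
    by (simp add: algebra_simps)

  define K where "K = FT (- c) (\<lambda>x. cis (c * s * x))"
  have K: "continuous_on S K" for S
    unfolding K_def by (intro continuous_on_FT continuous_intros)
  have P: "FT (- c) G t = of_real ((cmod l)\<^sup>2) * f t + g 1 * K t" if t: "t \<in> {-1..1}" "t \<noteq> s" for t
  proof -
    define e where "e x = cis (- c * (t - s) * x)" for x
    \<comment> \<open>Subtracting \<open>g 1\<close> makes h vanish at both endpoints, so
      integration by parts leaves no boundary terms.\<close>
    define h where "h x = g x - g 1" for x
    define J where "J = integral {-1..1} (\<lambda>x. h x * e x)"
    have e_deriv: "(e has_vector_derivative - \<i> * of_real (c * (t - s)) * e x) (at x within {-1..1})" for x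
      using has_vector_derivative_cis_mult[of "- c * (t - s)" x "{-1..1}"] by (simp add: e_def[abs_def] algebra_simps)
    have cg: "continuous_on {-1..1} g"
      unfolding g_def[abs_def] by (intro continuous_intros G)
    have J: "((\<lambda>x. h x * e x) has_integral J) {-1..1}"
      unfolding J_def h_def e_def
      by (intro integrable_integral integrable_continuous_real continuous_intros cg)
    have "((\<lambda>x. h x * (- \<i> * of_real (c * (t - s)) * e x) + \<i> * of_real c * l * (u x * cis (- c * s * x)) * e x)
        has_integral h 1 * e 1 - h (-1) * e (-1)) {-1..1}"
    proof (rule fundamental_theorem_of_calculus)
      fix x :: real assume x: "x \<in> {-1..1}"
      have "(h has_vector_derivative \<i> * of_real c * l * (u x * cis (- c * s * x))) (at x within {-1..1})"
        using has_vector_derivative_diff[OF g_deriv[OF x] has_vector_derivative_const] by (simp add: h_def[abs_def])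
      from has_vector_derivative_mult[OF this e_deriv]
      show "((\<lambda>x. h x * e x) has_vector_derivative
        h x * (- \<i> * of_real (c * (t - s)) * e x) + \<i> * of_real c * l * (u x * cis (- c * s * x)) * e x)
        (at x within {-1..1})" .
    qed simp
    then have "((\<lambda>x. - \<i> * of_real (c * (t - s)) * (h x * e x) + \<i> * of_real c * l * (u x * cis (- c * t * x)))
        has_integral 0) {-1..1}" (is "(?w has_integral 0) _")
      by (simp add: h_def g_end e_def cis_mult algebra_simps)
    moreover have "(?w has_integral - \<i> * of_real (c * (t - s)) * J + \<i> * of_real c * l * FT (- c) u t) {-1..1}"
      by (intro has_integral_add has_integral_mult_right J has_integral_FT U.cont)
    ultimately have "- \<i> * of_real (c * (t - s)) * J + \<i> * of_real c * l * FT (- c) u t = 0"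
      by (blast dest: has_integral_unique)
    then have "\<i> * of_real c * (of_real (t - s) * J) = \<i> * of_real c * (of_real (t - s) * (l * cnj l * f t))"
      by (simp add: eigen_neg(1)[OF t(1)] f(2)[OF t(1), symmetric] algebra_simps)
    then have J_eq: "J = of_real ((cmod l)\<^sup>2) * f t"
      unfolding complex_norm_square using c t(2) by simp
    have "((\<lambda>x. h x * e x + g 1 * (cis (c * s * x) * cis (- c * t * x))) has_integral J + g 1 * K t) {-1..1}"
      unfolding K_def by (intro has_integral_add has_integral_mult_right J has_integral_FT continuous_intros)
    moreover have "h x * e x + g 1 * (cis (c * s * x) * cis (- c * t * x)) = G x * cis (- c * t * x)" for x
      by (simp add: h_def e_def g_def cis_mult algebra_simps)
    ultimately show ?thesis
      unfolding J_eq FT_def[of "-c" G] by (simp add: integral_unique)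
  qed
  \<comment> \<open>Of |k|^2 = k * cnj k, the factor k moves F_c onto f and the factor
    \<open>cnj k\<close> moves the adjoint onto G, so that \<open>P\<close> applies off the null set
    {s}.\<close>
  have "of_real ((cmod k)\<^sup>2) * integral {-1..1} (\<lambda>t. f t * v t) = cnj k * integral {-1..1} (\<lambda>t. f t * FT c v t)"
    unfolding complex_norm_square integral_mult_right[symmetric]
    by (rule integral_cong) (simp add: V.eigen ac_simps)
  also have "\<dots> = integral {-1..1} (\<lambda>t. G t * (cnj k * v t))"
    unfolding integral_FT_swap[OF f(1) V.cont, symmetric] G_def integral_mult_right[symmetric]
    by (simp add: ac_simps)
  also have "\<dots> = integral {-1..1} (\<lambda>t. G t * FT (- c) v t)"
    by (rule integral_cong) (simp add: eigen_neg)
  also have "\<dots> = integral {-1..1} (\<lambda>t. FT (- c) G t * v t)"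
    by (rule integral_FT_swap[symmetric, OF G V.cont])
  also have "\<dots> = integral {-1..1} (\<lambda>t. of_real ((cmod l)\<^sup>2) * (f t * v t) + g 1 * (K t * v t))"
    by (rule integral_spike[of "{s}"]) (auto simp: P algebra_simps)
  also have "\<dots> = of_real ((cmod l)\<^sup>2) * integral {-1..1} (\<lambda>t. f t * v t) + g 1 * integral {-1..1} (\<lambda>t. K t * v t)"
    by (intro integral_unique has_integral_add has_integral_mult_right integrable_integral
      integrable_continuous_real continuous_intros f V.cont K)
  also have "integral {-1..1} (\<lambda>t. K t * v t) = integral {-1..1} (\<lambda>t. cis (c * s * t) * FT (- c) v t)"
    unfolding K_def by (intro integral_FT_swap continuous_intros V.cont)
  also have "\<dots> = integral {-1..1} (\<lambda>t. cnj k * (v t * cis (c * s * t)))"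
    by (rule integral_cong) (simp add: eigen_neg)
  also have "\<dots> = cnj k * FT c v s"
    by (simp add: FT_def)
  also have "\<dots> = of_real ((cmod k)\<^sup>2) * v s"
    unfolding complex_norm_square by (simp add: V.eigen[OF s(1)])
  finally show ?thesis
    unfolding g1[symmetric] by (simp add: algebra_simps)
qed

end

section \<open>Removable singularities and the passage between the two integrals\<close>

lemma continuous_on_difference_quotient:
  fixes f :: "real \<Rightarrow> real"
  assumes f: "continuous_on S f" and d: "(f has_real_derivative d) (at s)"
  shows "continuous_on S (\<lambda>t. if t = s then d else (f t - f s) / (t - s))" (is "continuous_on S ?q")
  unfolding continuous_on_eq_continuous_within
proof
  fix x assume x: "x \<in> S"
  show "continuous (at x within S) ?q"
  proof (cases "x = s")
    case True
    have "((\<lambda>t. (f t - f s) / (t - s)) \<longlongrightarrow> d) (at s within S)"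
      using d unfolding has_field_derivative_iff by (rule tendsto_within_subset) simp
    then have "(?q \<longlongrightarrow> d) (at s within S)"
      by (rule Lim_transform_eventually) (auto simp: eventually_at_filter)
    with True show ?thesis by (simp add: continuous_within)
  next
    case False
    show ?thesis
    proof (rule continuous_transform_within[of _ _ "\<lambda>t. (f t - f s) / (t - s)" "dist x s"])
      show "continuous (at x within S) (\<lambda>t. (f t - f s) / (t - s))"
        using f x False by (auto intro!: continuous_intros simp: continuous_on_eq_continuous_within)
    qed (use x False in \<open>auto simp: dist_commute\<close>)
  qed
qed

text \<open>The exceptional point s absorbs the convention x / 0 = 0, by which the quotient in the
  theorem takes the value 0 at the root.\<close>

lemma set_lebesgue_integral_eq_integral_of_continuous:
  fixes f g :: "real \<Rightarrow> complex"
  assumes g: "continuous_on {a..b} g" and eq: "\<And>t. t \<in> {a..b} \<Longrightarrow> t \<noteq> s \<Longrightarrow> f t = g t"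
  shows "(LINT t:{a..b}|lborel. f t) = integral {a..b} g"
proof -
  have "(LINT t:{a..b}|lborel. f t) = (LINT t:{a..b}|lborel. g t)"
    unfolding set_lebesgue_integral_def
    by (rule integral_discrete_difference[of "{s}"]) (auto simp: eq indicator_def)
  also have "\<dots> = integral {a..b} g"
    by (intro set_borel_integral_eq_integral borel_integrable_atLeastAtMost' g)
  finally show ?thesis .
qed

section \<open>Prolate systems: continuity, nonvanishing at 1, distinct moduli\<close>

lemma pswf_systemD:
  assumes "pswf_system c psi lam"
  shows "lam n \<noteq> 0"
    and "lam n = \<i> ^ n * complex_of_real (cmod (lam n))"
    and "set_borel_measurable lborel {-1..1} (psi n)"
    and "set_integrable lborel {-1..1} (\<lambda>t. (psi n t)\<^sup>2)"
    and "\<forall>x\<in>{-1..1}. lam n * complex_of_real (psi n x) = Fc c (\<lambda>t. complex_of_real (psi n t)) x"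
    and "\<forall>x\<in>{-1..1}. psi n (-x) = (-1) ^ n * psi n x"
    and "finite (pswf_roots (psi n))"
    and "card (pswf_roots (psi n)) = n"
    and "\<forall>t\<in>pswf_roots (psi n). \<exists>d. (psi n has_real_derivative d) (at t) \<and> d \<noteq> 0"
    and "inj lam"
  using conjunct1[OF assms[unfolded pswf_system_def], THEN spec[of _ n]]
    conjunct1[OF conjunct2[OF assms[unfolded pswf_system_def]]]
  by - (elim conjE, assumption)+

lemma pswf_system_eigenfunction_cases:
  assumes "pswf_system c psi lam"
    and "set_borel_measurable lborel {-1..1} f" "set_integrable lborel {-1..1} (\<lambda>t. (cmod (f t))\<^sup>2)"
    and "AE x in lborel. x \<in> {-1..1} \<longrightarrow> \<mu> * f x = Fc c f x"
  obtains "AE x in lborel. x \<in> {-1..1} \<longrightarrow> f x = 0"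
  | k a where "\<mu> = lam k" "AE x in lborel. x \<in> {-1..1} \<longrightarrow> f x = a * complex_of_real (psi k x)"
  using conjunct2[OF conjunct2[OF assms(1)[unfolded pswf_system_def]], rule_format, of f \<mu>] assms(2-4)
  by blast

text \<open>Bootstrapping: square integrable implies integrable on [-1,1], hence F_c psi_n is
  continuous, hence so is psi_n = F_c psi_n / lambda_n.\<close>

lemma pswf_eigenfunction:
  assumes "pswf_system c psi lam"
  shows "FT_eigenfunction c (lam n) (\<lambda>t. of_real (psi n t))"
proof -
  let ?u = "\<lambda>t. complex_of_real (psi n t)"
  note l = pswf_systemD(1)[OF assms, of n] and eq = bspec[OF pswf_systemD(5)[OF assms, of n]]
  have "set_integrable lborel {-1..1} (psi n)"
    by (rule set_integrable_of_square_integrable[OF pswf_systemD(3,4)[OF assms]])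
  then have "integrable lborel (\<lambda>t. complex_of_real (indicator {-1..1} t *\<^sub>R psi n t))"
    unfolding set_integrable_def by (rule integrable_of_real)
  then have "set_integrable lborel {-1..1} ?u"
    unfolding set_integrable_def by (simp add: scaleR_conv_of_real)
  then have "continuous_on {-1..1} (\<lambda>x. Fc c ?u x / lam n)"
    by (intro continuous_intros continuous_on_Fc) (auto simp: l)
  then have cont: "continuous_on {-1..1} ?u"
    by (rule continuous_on_eq) (simp add: eq[symmetric] l)
  show ?thesis
    by unfold_locales (use l cont eq in \<open>auto simp flip: Fc_eq_FT\<close>)
qed

lemma pswf_at_1_nonzero:
  assumes sys: "pswf_system c psi lam"
  shows "psi n 1 \<noteq> 0"
proof
  assume psi1: "psi n 1 = 0"
  interpret FT_eigenfunction c "lam n" "\<lambda>t. of_real (psi n t)"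
    by (rule pswf_eigenfunction[OF sys])
  \<comment> \<open>L psi_n satisfies the eigenvalue equation for lambda_n; it is either null,
    giving a = 0, or a multiple of some psi_k with lambda_k = lambda_n, and injectivity forces k =
    n.\<close>
  have "\<exists>a. AE x in lborel. x \<in> {-1..1} \<longrightarrow> Lu x = a * of_real (psi n x)"
  proof (rule pswf_system_eigenfunction_cases[OF sys, of Lu "lam n"])
    show "set_borel_measurable lborel {-1..1} Lu"
      using borel_integrable_atLeastAtMost'[OF cont_Lu]
      unfolding set_integrable_def set_borel_measurable_def by (rule borel_measurable_integrable)
    show "set_integrable lborel {-1..1} (\<lambda>t. (cmod (Lu t))\<^sup>2)"
      by (intro borel_integrable_atLeastAtMost' continuous_intros cont_Lu)
    show "AE x in lborel. x \<in> {-1..1} \<longrightarrow> lam n * Lu x = Fc c Lu x"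
      by (simp add: Fc_eq_FT[OF cont_Lu] Lu_eigen)
  next
    assume "AE x in lborel. x \<in> {-1..1} \<longrightarrow> Lu x = 0"
    then show ?thesis by (intro exI[of _ 0]) simp
  next
    fix k a assume "lam n = lam k" "AE x in lborel. x \<in> {-1..1} \<longrightarrow> Lu x = a * of_real (psi k x)"
    then show ?thesis using injD[OF pswf_systemD(10)[OF sys], of n k] by auto
  qed
  then obtain a where "AE x in lborel. x \<in> {-1..1} \<longrightarrow> Lu x = a * of_real (psi n x)" ..
  then obtain d where d: "0 \<le> d" "d < 1" "\<And>x. x \<in> {d..1} \<Longrightarrow> complex_of_real (psi n x) = 0"
    by (rule vanishes_near_1) (use psi1 in auto)
  then have "{d<..<1} \<subseteq> pswf_roots (psi n)"
    by (auto simp: pswf_roots_def)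
  moreover have "finite (pswf_roots (psi n))"
    by (rule pswf_systemD(7)[OF sys])
  ultimately show False
    using d(2) finite_subset infinite_Ioo by blast
qed

text \<open>With equal moduli, lambda_n^2 = (-1)^n r^2 shows the parity: for equal parities lambda_n
  = -lambda_m, as injectivity excludes the other sign; for opposite parities the squares are
  opposite. Either way a boundary lemma contradicts nonvanishing at 1.\<close>

lemma pswf_cmod_eigenvalues_distinct:
  assumes sys: "pswf_system c psi lam" and mn: "m \<noteq> n"
  shows "cmod (lam m) \<noteq> cmod (lam n)"
proof
  assume eq: "cmod (lam m) = cmod (lam n)"
  interpret FT_eigenfunction_pair c "lam m" "\<lambda>t. of_real (psi m t)" "lam n" "\<lambda>t. of_real (psi n t)"
    unfolding FT_eigenfunction_pair_def by (intro conjI pswf_eigenfunction[OF sys])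
  have nz: "complex_of_real (psi m 1) * of_real (psi n 1) \<noteq> 0"
    using pswf_at_1_nonzero[OF sys] by simp
  define r where "r = complex_of_real (cmod (lam n))"
  have lam: "lam m = \<i> ^ m * r" "lam n = \<i> ^ n * r"
    using pswf_systemD(2)[OF sys, of m] pswf_systemD(2)[OF sys, of n] by (simp_all add: r_def eq)
  have parity: "psi k (-1) = (-1) ^ k * psi k 1" for k
    using bspec[OF pswf_systemD(6)[OF sys, of k], of 1] by simp
  have i2: "(\<i> ^ k)\<^sup>2 = (-1) ^ k" for k :: nat
    by (simp flip: power_mult_distrib power_mult add: power_mult[of \<i> 2] mult.commute[of k])
  show False
  proof (cases "even m = even n")
    case True
    have "(\<i> ^ m)\<^sup>2 = (\<i> ^ n)\<^sup>2"
      unfolding i2 using True by (simp add: minus_one_power_iff)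
    then have "lam n = lam m \<or> lam n = - lam m"
      unfolding lam by (auto simp: power2_eq_iff)
    then have "lam n = - lam m"
      using mn injD[OF pswf_systemD(10)[OF sys], of n m] by auto
    from boundary_zero_if_opposite[OF this] nz show False
      using True by (auto simp: parity minus_one_power_iff)
  next
    case False
    have "(lam n)\<^sup>2 = - (lam m)\<^sup>2"
      unfolding lam power_mult_distrib i2 using False by (auto simp: minus_one_power_iff)
    from boundary_zero_if_squares_opposite[OF this] nz show False
      using False by (auto simp: parity minus_one_power_iff)
  qed
qed

theorem theorem59:
  fixes c :: real and psi :: "nat \<Rightarrow> real \<Rightarrow> real" and lam :: "nat \<Rightarrow> complex"
    and n m j :: nat
  assumes "c > 0"
    and "pswf_system c psi lam"
    and "n > 0" and "m \<noteq> n" and "1 \<le> j" and "j \<le> n"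
  defines "tj \<equiv> sorted_list_of_set (pswf_roots (psi n)) ! (j - 1)"
  shows "(LINT t:{-1..1}|lborel. complex_of_real (psi n t / (t - tj) * psi m t))
       = complex_of_real ((cmod (lam m))\<^sup>2 * psi m tj / ((cmod (lam m))\<^sup>2 - (cmod (lam n))\<^sup>2))
         * ((LINT t:{-1..1}|lborel. complex_of_real (psi n t / (t - tj)))
            + \<i> * complex_of_real c * lam n * Psi c (psi n) 1 tj)"
proof -
  note sys = assms(2)
  interpret FT_eigenfunction_pair c "lam n" "\<lambda>t. of_real (psi n t)" "lam m" "\<lambda>t. of_real (psi m t)"
    unfolding FT_eigenfunction_pair_def by (intro conjI pswf_eigenfunction[OF sys])
  \<comment> \<open>There are exactly n roots, so the zero-based index j - 1 lies within the sorted
    list.\<close>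
  have root: "tj \<in> pswf_roots (psi n)"
    using pswf_systemD(7,8)[OF sys, of n] assms(3,5,6) nth_mem[of "j - 1" "sorted_list_of_set (pswf_roots (psi n))"] by (simp add: tj_def)
  then have tj: "-1 < tj" "tj < 1" "psi n tj = 0"
    by (auto simp: pswf_roots_def)
  obtain d where d: "(psi n has_real_derivative d) (at tj)"
    using pswf_systemD(9)[OF sys] root by blast
  \<comment> \<open>The continuous extension of the quotient, with the derivative of psi_n as its
    value at the root.\<close>
  define q where "q t = (if t = tj then d else psi n t / (t - tj))" for t
  have "continuous_on {-1..1} (\<lambda>t. Re (complex_of_real (psi n t)))"
    by (intro continuous_intros U.cont)
  then have q: "continuous_on {-1..1} (\<lambda>t. complex_of_real (q t))"
    using continuous_on_difference_quotient[OF _ d, of "{-1..1}"] tj(3)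
    by (intro continuous_intros) (simp add: q_def[abs_def] cong: if_cong)
  have lhs: "(LINT t:{-1..1}|lborel. complex_of_real (psi n t / (t - tj) * psi m t))
      = integral {-1..1} (\<lambda>t. of_real (q t) * of_real (psi m t))"
    by (rule set_lebesgue_integral_eq_integral_of_continuous[where s = tj, OF continuous_on_mult[OF q V.cont]])
      (simp add: q_def)
  have rhs: "(LINT t:{-1..1}|lborel. complex_of_real (psi n t / (t - tj))) = integral {-1..1} (\<lambda>t. of_real (q t))"
    by (rule set_lebesgue_integral_eq_integral_of_continuous[where s = tj, OF q]) (simp add: q_def)
  have Psi: "Psi c (psi n) 1 tj = integral {0..1} (\<lambda>x. of_real (psi n x) * cis (- (c * x * tj)))"
    unfolding Psi_def
    by (rule set_lebesgue_integral_eq_integral_of_continuous)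
      (auto intro!: continuous_intros continuous_on_subset[OF U.cont] simp: cis_conv_exp)
  have "(cmod (lam m))\<^sup>2 - (cmod (lam n))\<^sup>2 \<noteq> 0"
    using pswf_cmod_eigenvalues_distinct[OF sys \<open>m \<noteq> n\<close>] by (simp add: power2_eq_iff_nonneg)
  moreover have "of_real ((cmod (lam m))\<^sup>2 - (cmod (lam n))\<^sup>2) * integral {-1..1} (\<lambda>t. of_real (q t) * of_real (psi m t))
      = of_real ((cmod (lam m))\<^sup>2) * of_real (psi m tj) * (integral {-1..1} (\<lambda>t. of_real (q t))
        + \<i> * of_real c * lam n * integral {0..1} (\<lambda>x. of_real (psi n x) * cis (- (c * x * tj))))"
    by (rule integral_divided_difference) (use assms(1) tj q in \<open>auto simp: q_def simp flip: of_real_mult\<close>)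
  ultimately show ?thesis
    unfolding lhs rhs Psi
    by (simp add: field_simps del: of_real_diff of_real_power)
qed

end
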